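(* Suppose $\{\lambda_n\}_{n\ge1}\subset\mathbb{D}$ is an interpolating sequence and $\{w_n\}_{n\ge1} \subset \mathbb{C} \setminus \{0\}$ is bounded and satisfies $$\limsup_{n \to \infty}\, (1-|\lambda_n|)\,\big|\log|w_n|\big| = \infty.$$ Then any $\phi \in N^{+}$ for which $\phi(\lambda_n) = w_n$ for all $n \geq 1$ must have a (nonconstant) Blaschke factor, i.e. $\phi$ has at least one zero in $\mathbb{D}$.
   Context: $\mathbb{D}$ is the open unit disk in $\mathbb{C}$, $\mathbb{T}$ the unit circle, $m$ normalized Lebesgue measure on $\mathbb{T}$, $H^\infty$ the bounded analytic functions on $\mathbb{D}$. A sequence $\Lambda=\{\lambda_n\}_{n\ge1}$ of distinct points of $\mathbb{D}$ is interpolating if $\delta(\Lambda) := \inf_{n \geq 1} \prod_{k\ge 1, k \ne n} \left| \frac{\lambda_k-\lambda_n}{1-\overline{\lambda}_k \lambda_n}\right| > 0$. An outer function is an analytic function on $\mathbb{D}$ of the form $\phi(z)=\gamma\exp\big(\int_{\mathbb{T}} \frac{\xi + z}{\xi - z} W(\xi)\, dm(\xi)\big)$, where $|\gamma|=1$ and $W$ is an extended real-valued integrable function on $\mathbb{T}$. The Smirnov class is $N^{+} = \{f/g: f \in H^{\infty},\ g \in H^{\infty} \text{ outer}\}$. Every $F \in N^{+}$, $F\not\equiv0$, factors as $F=I_FO_F$ with $I_F$ inner and $O_F$ outer; the Blaschke factor of $F$ is the Blaschke product formed from the zeros of $F$ in $\mathbb{D}$. *)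

theory Defs
  imports "HOL-Complex_Analysis.Complex_Analysis"
begin

abbreviation unit_disk :: "complex set" where
  "unit_disk \<equiv> ball 0 1"

definition circle_measure :: "complex measure" where
  "circle_measure = completion
     (distr (uniform_measure lborel {0..2 * pi}) (restrict_space borel (sphere 0 1)) cis)"

(* The partial products are decreasing in N, so the limit always exists.  Using prodinf
   instead would be wrong: has_prod excludes products that diverge to 0. *)
definition interpolation_delta :: "(nat \<Rightarrow> complex) \<Rightarrow> real" where
  "interpolation_delta \<Lambda> =
     (INF n. lim (\<lambda>N. \<Prod>k\<in>{..<N} - {n}. cmod ((\<Lambda> k - \<Lambda> n) / (1 - cnj (\<Lambda> k) * \<Lambda> n))))"

definition interpolating_sequence :: "(nat \<Rightarrow> complex) \<Rightarrow> bool" where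
  "interpolating_sequence \<Lambda> \<longleftrightarrow>
     range \<Lambda> \<subseteq> unit_disk \<and> inj \<Lambda> \<and> interpolation_delta \<Lambda> > 0"

definition H_infinity :: "(complex \<Rightarrow> complex) set" where
  "H_infinity = {f. f holomorphic_on unit_disk \<and> bounded (f ` unit_disk)}"

(* An integrable W is finite almost everywhere, so the value 0 that real_of_ereal
   assigns to infinite arguments does not affect the integral. *)
definition outer_function :: "(complex \<Rightarrow> complex) \<Rightarrow> bool" where
  "outer_function \<phi> \<longleftrightarrow> \<phi> holomorphic_on unit_disk \<and>
     (\<exists>(\<gamma>::complex) (W::complex \<Rightarrow> ereal).
        cmod \<gamma> = 1 \<and>
        W \<in> borel_measurable circle_measure \<and>
        (\<integral>\<^sup>+ \<xi>. e2ennreal \<bar>W \<xi>\<bar> \<partial>circle_measure) < \<infinity> \<and>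
        (\<forall>z\<in>unit_disk. \<phi> z =
           \<gamma> * exp (LINT \<xi>|circle_measure. (\<xi> + z) / (\<xi> - z) * of_real (real_of_ereal (W \<xi>)))))"

(* Functions on the disk are total functions on the complex plane whose values
   off the disk are irrelevant. *)
definition smirnov_class :: "(complex \<Rightarrow> complex) set" where
  "smirnov_class =
     {F. \<exists>f\<in>H_infinity. \<exists>g\<in>H_infinity. outer_function g \<and> (\<forall>z\<in>unit_disk. F z = f z / g z)}"

definition disk_zeros :: "(complex \<Rightarrow> complex) \<Rightarrow> complex set" where
  "disk_zeros F = {a \<in> unit_disk. F a = 0}"

definition blaschke_term :: "complex \<Rightarrow> complex \<Rightarrow> complex" where
  "blaschke_term a z =
     (if a = 0 then z else of_real (cmod a) / a * ((a - z) / (1 - cnj a * z)))"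

(* B is the Blaschke product formed from the zeros of F in the disk, counted with
   multiplicity; F is meant to be holomorphic and not identically zero there.  The product
   converges unconditionally, so it is taken as a limit over finite sets of zeros. *)
definition is_blaschke_factor :: "(complex \<Rightarrow> complex) \<Rightarrow> (complex \<Rightarrow> complex) \<Rightarrow> bool" where
  "is_blaschke_factor F B \<longleftrightarrow>
     (\<forall>z\<in>unit_disk.
        ((\<lambda>X. \<Prod>a\<in>X. blaschke_term a z ^ nat (zorder F a)) \<longlongrightarrow> B z)
          (finite_subsets_at_top (disk_zeros F)))"

end

theory Submission imports Defs begin

text \<open>Write \<open>\<phi> = f / g\<close> with \<open>f\<close> bounded and \<open>g\<close> bounded and zero-free. If \<open>\<phi>\<close> had no zero,
  then neither would \<open>f\<close>, and \<open>- ln \<bar>f\<bar>\<close> and \<open>- ln \<bar>g\<bar>\<close> would be harmonic and bounded below;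
  by Harnack's inequality both are \<open>O(1 / (1 - \<bar>z\<bar>))\<close>, against the growth hypothesis. Hence \<open>\<phi>\<close>
  has a zero. Dividing \<open>f\<close> by finite Blaschke products does not increase its bound, which
  at a point \<open>z\<^sub>0\<close> with \<open>f z\<^sub>0 \<noteq> 0\<close> gives the Blaschke condition, and so the Blaschke product
  converges to a function with exactly the zeros of \<open>\<phi>\<close>.\<close>

section \<open>Schwarz-Pick and division by one Moebius factor\<close>

text \<open>Schwarz's lemma asks for a strict bound, so it is applied to \<open>f / (M + e)\<close>
  and \<open>e\<close> is then sent to 0; the shift also covers \<open>M = 0\<close>.\<close>

lemma Schwarz_Lemma_bound:
  assumes holf: "f holomorphic_on ball 0 1" and f0: "f 0 = 0"
    and bd: "\<And>z. norm z < 1 \<Longrightarrow> norm (f z) \<le> M" and z: "norm z < 1"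
  shows "norm (f z) \<le> M * norm z"
proof (rule field_le_epsilon)
  fix e :: real assume e: "e > 0"
  have M: "M \<ge> 0" using bd[of 0] f0 by simp
  have "norm (f z / of_real (M + e)) \<le> norm z"
  proof (rule Schwarz_Lemma[OF _ _ _ z])
    show "(\<lambda>w. f w / of_real (M + e)) holomorphic_on ball 0 1"
      using M e by (intro holomorphic_intros holf) (simp add: complex_eq_iff)
    show "norm (f w / of_real (M + e)) < 1" if "norm w < 1" for w
      using bd[OF that] M e by (simp add: norm_divide del: of_real_add)
  qed (simp add: f0)
  then have "norm (f z) \<le> (M + e) * norm z"
    using M e by (simp add: norm_divide divide_simps mult_ac del: of_real_add)
  also have "\<dots> \<le> M * norm z + e"
    using mult_left_le[of "norm z" e] e z by (simp add: algebra_simps)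
  finally show "norm (f z) \<le> M * norm z + e" .
qed

lemma one_minus_cnj_mult_nonzero:
  assumes "norm a < 1" "norm z < 1"
  shows "1 - cnj a * z \<noteq> 0"
proof
  assume "1 - cnj a * z = 0"
  then have "norm (cnj a * z) = 1"
    by (metis eq_iff_diff_eq_0 norm_one)
  then show False
    using norm_mult_less[of "cnj a" 1 z 1] assms by simp
qed

text \<open>Precomposing with \<open>Moebius_function 0 (- a)\<close>, the inverse of
  \<open>Moebius_function 0 a\<close>, moves the zero from \<open>a\<close> to 0.\<close>

lemma Schwarz_Pick_bound:
  assumes holf: "f holomorphic_on ball 0 1" and fa: "f a = 0" and a: "norm a < 1"
    and bd: "\<And>z. norm z < 1 \<Longrightarrow> norm (f z) \<le> M" and z: "norm z < 1"
  shows "norm (f z) \<le> M * norm (Moebius_function 0 a z)"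
proof -
  let ?g = "f \<circ> Moebius_function 0 (- a)"
  have "norm (?g (Moebius_function 0 a z)) \<le> M * norm (Moebius_function 0 a z)"
  proof (rule Schwarz_Lemma_bound)
    show "?g holomorphic_on ball 0 1"
      using a Moebius_function_norm_lt_1[of "-a"]
      by (intro holomorphic_on_compose_gen[OF _ holf] Moebius_function_holomorphic) auto
    show "?g 0 = 0"
      by (simp add: Moebius_function_of_zero fa)
    show "norm (?g w) \<le> M" if "norm w < 1" for w
      using bd Moebius_function_norm_lt_1[of "-a" w] a that by simp
    show "norm (Moebius_function 0 a z) < 1"
      using Moebius_function_norm_lt_1 a z by simp
  qed
  then show ?thesis
    using Moebius_function_compose[of "-a" a z] a z by simp
qed

lemma Moebius_divide:
  assumes holf: "f holomorphic_on ball 0 1" and fa: "f a = 0" and a: "norm a < 1"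
    and bd: "\<And>z. norm z < 1 \<Longrightarrow> norm (f z) \<le> M"
  obtains g where "g holomorphic_on ball 0 1"
    "\<And>z. norm z < 1 \<Longrightarrow> norm (g z) \<le> M"
    "\<And>z. norm z < 1 \<Longrightarrow> f z = Moebius_function 0 a z * g z"
proof -
  \<comment> \<open>\<open>h\<close> is the difference quotient with its removable singularity at
    \<open>a\<close> filled in; the factor \<open>1 - cnj a * z\<close> in \<open>g\<close> turns
    \<open>z - a\<close> into the Moebius factor.\<close>
  define h where "h = (\<lambda>z. if z = a then deriv f a else (f z - f a) / (z - a))"
  define g where "g = (\<lambda>z. (1 - cnj a * z) * h z)"
  have holg: "g holomorphic_on ball 0 1"
    unfolding g_def h_def by (intro holomorphic_intros pole_lemma_open holf) auto
  have eq: "f z = Moebius_function 0 a z * g z" if "norm z < 1" for z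
    using one_minus_cnj_mult_nonzero[OF a that] fa
    by (auto simp: g_def h_def Moebius_function_simple)
  have off: "norm (g z) \<le> M" if "norm z < 1" "z \<noteq> a" for z
  proof -
    have "norm (Moebius_function 0 a z) > 0"
      using that one_minus_cnj_mult_nonzero[OF a that(1)] by (simp add: Moebius_function_simple)
    moreover have "norm (Moebius_function 0 a z) * norm (g z) \<le> M * norm (Moebius_function 0 a z)"
      using Schwarz_Pick_bound[OF holf fa a bd that(1)] eq[OF that(1)] by (simp add: norm_mult)
    ultimately show ?thesis
      by (simp add: mult.commute)
  qed
  \<comment> \<open>At \<open>a\<close> the Moebius factor vanishes and cannot be cancelled, so the
    bound is carried there by continuity.\<close>
  have "isCont g a"
    using holg a by (meson continuous_on_eq_continuous_at holomorphic_on_imp_continuous_on mem_ball_0 open_ball)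
  then have "((\<lambda>z. norm (g z)) \<longlongrightarrow> norm (g a)) (at a)"
    by (intro tendsto_norm) (simp add: isCont_def)
  moreover have "eventually (\<lambda>z. norm (g z) \<le> M) (at a)"
    using eventually_at_in_open[of "ball 0 1" a] a
    by (auto elim!: eventually_mono intro!: off)
  ultimately have "norm (g a) \<le> M"
    by (rule tendsto_upperbound) simp
  with off have "norm (g z) \<le> M" if "norm z < 1" for z
    using that by (cases "z = a") auto
  with that holg eq show thesis by blast
qed

section \<open>Orders of zeros in the disk\<close>

lemma analytic_at_disk:
  assumes "f holomorphic_on ball 0 1" "norm x < 1"
  shows "f analytic_on {x}"
  using assms by (intro analytic_on_holomorphic[THEN iffD2] exI[of _ "ball 0 1"]) auto

text \<open>By the identity theorem on the connected disk, one point \<open>z0\<close> where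
  \<open>f\<close> does not vanish makes all zeros isolated, including a possible zero at
  \<open>x\<close>.\<close>

lemma eventually_nonzero_disk:
  assumes holf: "f holomorphic_on ball 0 1" and "norm z0 < 1" "f z0 \<noteq> 0" and x: "norm x < 1"
  shows "eventually (\<lambda>z. f z \<noteq> 0) (at x)"
proof -
  have "eventually (\<lambda>z. f z \<noteq> 0 \<and> z \<in> ball 0 1) (at x)"
    using assms by (intro non_zero_neighbour_alt[OF holf, of x z0]) auto
  then show ?thesis by (rule eventually_mono) auto
qed

text \<open>Additivity of \<open>zorder\<close> requires that the product not vanish identically
  near \<open>x\<close>; the point \<open>z0\<close> provides this.\<close>

lemma zorder_mult_disk:
  assumes p: "p holomorphic_on ball 0 1" and q: "q holomorphic_on ball 0 1"
    and eq: "\<And>z. norm z < 1 \<Longrightarrow> f z = p z * q z"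
    and nz: "norm z0 < 1" "f z0 \<noteq> 0" and x: "norm x < 1"
  shows "zorder f x = zorder p x + zorder q x"
proof -
  have pq: "(\<lambda>z. p z * q z) holomorphic_on ball 0 1"
    by (intro holomorphic_intros p q)
  have "eventually (\<lambda>z. z \<in> ball 0 1) (nhds x)"
    using x by (intro eventually_nhds_in_open) auto
  then have "eventually (\<lambda>z. f z = p z * q z) (nhds x)"
    by (rule eventually_mono) (use eq in auto)
  then have "zorder f x = zorder (\<lambda>z. p z * q z) x"
    by (intro zorder_cong) (auto simp: eventually_nhds_conv_at)
  also have "\<dots> = zorder p x + zorder q x"
  proof (rule zorder_times_analytic)
    show "p analytic_on {x}" "q analytic_on {x}"
      using p q x by (auto intro: analytic_at_disk)
    show "eventually (\<lambda>z. p z * q z \<noteq> 0) (at x)"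
      using eventually_nonzero_disk[OF pq nz(1) _ x] eq[OF nz(1)] nz(2) by simp
  qed
  finally show ?thesis .
qed

lemma zorder_Moebius:
  assumes "norm a < 1"
  shows "zorder (Moebius_function 0 a) a = 1"
proof (rule zorder_eqI[of "ball 0 1" _ "\<lambda>z. inverse (1 - cnj a * z)"])
  show "(\<lambda>z. inverse (1 - cnj a * z)) holomorphic_on ball 0 1"
    using one_minus_cnj_mult_nonzero[OF assms] by (intro holomorphic_intros) auto
qed (use assms one_minus_cnj_mult_nonzero[OF assms assms] in
     \<open>auto simp: Moebius_function_simple field_simps\<close>)

section \<open>Dividing out finite Blaschke products\<close>

text \<open>Induction on the order of the zero: each division by the Moebius factor lowers the order
  at \<open>a\<close> by one and keeps the bound \<open>M\<close>.\<close>

lemma Moebius_divide_power: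
  assumes "f holomorphic_on ball 0 1" and a: "norm a < 1"
    and "\<And>z. norm z < 1 \<Longrightarrow> norm (f z) \<le> M"
    and "norm z0 < 1" "f z0 \<noteq> 0"
  shows "\<exists>g. g holomorphic_on ball 0 1 \<and> (\<forall>z. norm z < 1 \<longrightarrow> norm (g z) \<le> M) \<and>
    (\<forall>z. norm z < 1 \<longrightarrow> f z = Moebius_function 0 a z ^ nat (zorder f a) * g z)"
  using assms
proof (induction "nat (zorder f a)" arbitrary: f)
  case 0
  then show ?case by (intro exI[of _ f]) simp
next
  case (Suc n)
  note holf = Suc.prems(1) and bd = Suc.prems(3) and nz = Suc.prems(4,5)
  have "frequently (\<lambda>z. f z \<noteq> 0) (at a)"
    using eventually_nonzero_disk[OF holf nz a] by (intro eventually_frequently) auto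
  moreover have "zorder f a > 0" using Suc.hyps(2) by linarith
  ultimately have "f a = 0"
    using zorder_pos_iff[OF holf, of a] a by simp
  then obtain g where g: "g holomorphic_on ball 0 1"
    "\<And>z. norm z < 1 \<Longrightarrow> norm (g z) \<le> M"
    "\<And>z. norm z < 1 \<Longrightarrow> f z = Moebius_function 0 a z * g z"
    using Moebius_divide[OF holf _ a bd] by metis
  have "zorder f a = 1 + zorder g a"
    using zorder_mult_disk[OF Moebius_function_holomorphic[OF a] g(1) g(3) nz a]
    by (simp add: zorder_Moebius a)
  with Suc.hyps(2) have n: "n = nat (zorder g a)" by simp
  have "g z0 \<noteq> 0" using g(3) nz by auto
  from Suc.hyps(1)[OF n g(1) a g(2) nz(1) this]
  obtain k where k: "k holomorphic_on ball 0 1" "\<forall>z. norm z < 1 \<longrightarrow> norm (k z) \<le> M"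
    "\<forall>z. norm z < 1 \<longrightarrow> g z = Moebius_function 0 a z ^ n * k z"
    unfolding n by blast
  show ?case
    by (rule exI[of _ k], unfold Suc.hyps(2)[symmetric]) (use k g(3) in auto)
qed

text \<open>The zeros are removed one point at a time. What matters later is that the bound
  \<open>M\<close> on the cofactor does not depend on \<open>X\<close>.\<close>

lemma Moebius_divide_prod:
  assumes holf: "f holomorphic_on ball 0 1"
    and bd: "\<And>z. norm z < 1 \<Longrightarrow> norm (f z) \<le> M"
    and nz: "norm z0 < 1" "f z0 \<noteq> 0"
    and "finite X" "X \<subseteq> ball 0 1"
  shows "\<exists>g. g holomorphic_on ball 0 1 \<and> (\<forall>z. norm z < 1 \<longrightarrow> norm (g z) \<le> M) \<and>
    (\<forall>z. norm z < 1 \<longrightarrow> f z = (\<Prod>a\<in>X. Moebius_function 0 a z ^ nat (zorder f a)) * g z)"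
  using \<open>finite X\<close> \<open>X \<subseteq> ball 0 1\<close>
proof (induction X)
  case empty
  then show ?case using holf bd by (intro exI[of _ f]) simp
next
  case (insert a X)
  let ?P = "\<lambda>z. \<Prod>a\<in>X. Moebius_function 0 a z ^ nat (zorder f a)"
  from insert obtain g where g: "g holomorphic_on ball 0 1"
    "\<And>z. norm z < 1 \<Longrightarrow> norm (g z) \<le> M" "\<And>z. norm z < 1 \<Longrightarrow> f z = ?P z * g z"
    by auto
  have a: "norm a < 1" using insert.prems by simp
  have holP: "?P holomorphic_on ball 0 1"
    using insert.prems by (intro holomorphic_intros Moebius_function_holomorphic) auto
  \<comment> \<open>Each factor of \<open>?P\<close> vanishes only at its own point of
    \<open>X\<close>, and \<open>a\<close> is not in \<open>X\<close>; hence the cofactor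
    \<open>g\<close> still has the full order of \<open>f\<close> at \<open>a\<close>.\<close>
  have "?P a \<noteq> 0"
    using insert one_minus_cnj_mult_nonzero[OF _ a] by (auto simp: Moebius_function_simple)
  then have "zorder ?P a = 0"
    using holP a by (intro zorder_eq_0I analytic_at_disk)
  then have ord: "zorder f a = zorder g a"
    using zorder_mult_disk[OF holP g(1) g(3) nz a] by simp
  have "g z0 \<noteq> 0" using g(3) nz by auto
  from Moebius_divide_power[OF g(1) a g(2) nz(1) this]
  obtain k where "k holomorphic_on ball 0 1" "\<forall>z. norm z < 1 \<longrightarrow> norm (k z) \<le> M"
    "\<forall>z. norm z < 1 \<longrightarrow> g z = Moebius_function 0 a z ^ nat (zorder f a) * k z"
    unfolding ord by blast
  with g(3) show ?case
    using insert.hyps by (intro exI[of _ k]) auto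
qed

section \<open>The Blaschke condition\<close>

text \<open>With \<open>r\<close> the modulus of the Moebius function and \<open>d\<close> that of
  its denominator, \<open>(1 - r^2) * d^2 = (1 - |a|^2) * (1 - |z|^2)\<close>. The 8 comes from
  \<open>d^2 \<le> 4\<close> and \<open>1 - r^2 \<le> 2 * (1 - r)\<close>.\<close>

lemma one_minus_norm_Moebius_ge:
  assumes a: "norm a < 1" and z: "norm z < 1"
  shows "(1 - norm a) * (1 - (norm z)\<^sup>2) / 8 \<le> 1 - norm (Moebius_function 0 a z)"
proof -
  define r where "r = norm (Moebius_function 0 a z)"
  define d where "d = norm (1 - cnj a * z)"
  have d0: "d > 0" using one_minus_cnj_mult_nonzero[OF a z] by (simp add: d_def)
  have "d \<le> 1 + norm (cnj a * z)"
    unfolding d_def using norm_triangle_ineq4[of 1 "cnj a * z"] by simp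
  also have "\<dots> \<le> 2" using norm_mult_less[of "cnj a" 1 z 1] a z by simp
  finally have d2: "d\<^sup>2 \<le> 4" using power_mono[of d 2 2] d0 by simp
  have r0: "r \<ge> 0" and r1: "r < 1"
    using Moebius_function_norm_lt_1[OF a z] by (auto simp: r_def)
  have "(norm (z - a))\<^sup>2 = d\<^sup>2 - (1 - (norm a)\<^sup>2) * (1 - (norm z)\<^sup>2)"
    unfolding d_def cmod_power2 by (simp add: algebra_simps power2_eq_square)
  then have "(r * d)\<^sup>2 = d\<^sup>2 - (1 - (norm a)\<^sup>2) * (1 - (norm z)\<^sup>2)"
    using d0 by (simp add: r_def d_def Moebius_function_simple norm_divide)
  then have *: "(1 - (norm a)\<^sup>2) * (1 - (norm z)\<^sup>2) = (1 - r\<^sup>2) * d\<^sup>2"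
    by (simp add: algebra_simps power_mult_distrib)
  have "(1 - norm a) * (1 - (norm z)\<^sup>2) \<le> (1 - (norm a)\<^sup>2) * (1 - (norm z)\<^sup>2)"
  proof (rule mult_right_mono)
    show "1 - norm a \<le> 1 - (norm a)\<^sup>2"
      using a mult_left_le[of "norm a" "norm a"] by (simp add: power2_eq_square)
    show "0 \<le> 1 - (norm z)\<^sup>2"
      using z by (simp add: power_le_one)
  qed
  also have "\<dots> \<le> (1 - r\<^sup>2) * 4"
    unfolding * using d2 r0 r1 by (intro mult_left_mono) (auto simp: power_le_one)
  also have "1 - r\<^sup>2 \<le> 2 * (1 - r)"
    using sum_power2_ge_zero[of "1 - r" 0] by (simp add: power2_eq_square algebra_simps)
  finally show ?thesis by (simp add: r_def)
qed

text \<open>Dividing out the zeros in a finite \<open>X\<close> bounds \<open>|f z0|\<close> by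
  \<open>M\<close> times the product of the \<open>r a ^ m a\<close>. Taking logarithms, with
  \<open>- ln r \<ge> 1 - r \<ge> c * (1 - |a|)\<close>, bounds every finite sum independently of
  \<open>X\<close>.\<close>

lemma Blaschke_condition:
  assumes holf: "f holomorphic_on ball 0 1"
    and bd: "\<And>z. norm z < 1 \<Longrightarrow> norm (f z) \<le> M"
    and nz: "norm z0 < 1" "f z0 \<noteq> 0"
    and Z: "Z \<subseteq> ball 0 1" "\<And>a. a \<in> Z \<Longrightarrow> f a = 0"
  shows "(\<lambda>a. real (nat (zorder f a)) * (1 - norm a)) summable_on Z"
proof (rule nonneg_bdd_above_summable_on)
  show "0 \<le> real (nat (zorder f a)) * (1 - norm a)" if "a \<in> Z" for a
    using that Z(1) by auto
  define c where "c = (1 - (norm z0)\<^sup>2) / 8"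
  have c: "c > 0" using nz by (simp add: c_def abs_square_less_1)
  have M: "M > 0" using bd[OF nz(1)] nz(2) by (smt (verit) zero_less_norm_iff)
  have "(\<Sum>a\<in>X. real (nat (zorder f a)) * (1 - norm a)) \<le> ln (M / norm (f z0)) / c"
    if X: "X \<subseteq> Z" "finite X" for X
  proof -
    define r where "r = (\<lambda>a. norm (Moebius_function 0 a z0))"
    define m where "m = (\<lambda>a. nat (zorder f a))"
    obtain g where g: "norm (g z0) \<le> M" "f z0 = (\<Prod>a\<in>X. Moebius_function 0 a z0 ^ m a) * g z0"
      using Moebius_divide_prod[OF holf bd nz X(2)] X(1) Z(1) nz(1) unfolding m_def by blast
    \<comment> \<open>\<open>f\<close> vanishes at \<open>a\<close> but not at \<open>z0\<close>, so
      the two points differ and the logarithms below are of positive numbers.\<close>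
    have r: "r a > 0" if "a \<in> X" for a
    proof -
      have "a \<noteq> z0" "norm a < 1" using that X Z nz by auto
      then show ?thesis
        using one_minus_cnj_mult_nonzero[OF _ nz(1)] by (simp add: r_def Moebius_function_simple)
    qed
    have P: "(\<Prod>a\<in>X. r a ^ m a) > 0" using r by (intro prod_pos) auto
    have "norm (f z0) = (\<Prod>a\<in>X. r a ^ m a) * norm (g z0)"
      unfolding g(2) by (simp add: norm_mult prod_norm[symmetric] norm_power r_def)
    also have "\<dots> \<le> (\<Prod>a\<in>X. r a ^ m a) * M"
      using g(1) P by (intro mult_left_mono) auto
    finally have "ln (norm (f z0)) \<le> ln ((\<Prod>a\<in>X. r a ^ m a) * M)"
      using nz(2) by (intro ln_mono) auto
    also have "\<dots> = (\<Sum>a\<in>X. ln (r a ^ m a)) + ln M"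
      using P M r X(2) by (subst ln_mult_pos, simp_all, subst ln_prod) force+
    also have "(\<Sum>a\<in>X. ln (r a ^ m a)) = (\<Sum>a\<in>X. real (m a) * ln (r a))"
      using r by (intro sum.cong) (auto simp: ln_realpow)
    also have "(\<Sum>a\<in>X. real (m a) * ln (r a)) \<le> (\<Sum>a\<in>X. - (real (m a) * (1 - norm a) * c))"
    proof (rule sum_mono)
      fix a assume a: "a \<in> X"
      have "(1 - norm a) * c \<le> 1 - r a"
        using one_minus_norm_Moebius_ge[OF _ nz(1), of a] a X Z by (auto simp: c_def r_def)
      also have "\<dots> \<le> - ln (r a)" using ln_le_minus_one[OF r[OF a]] by simp
      finally have "real (m a) * ((1 - norm a) * c) \<le> real (m a) * - ln (r a)"
        by (intro mult_left_mono) auto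
      then show "real (m a) * ln (r a) \<le> - (real (m a) * (1 - norm a) * c)"
        by (simp add: mult.assoc)
    qed
    finally have "(\<Sum>a\<in>X. real (m a) * (1 - norm a)) * c \<le> ln M - ln (norm (f z0))"
      by (simp add: sum_negf sum_distrib_right)
    then show ?thesis using c M nz by (simp add: ln_div pos_le_divide_eq m_def)
  qed
  then show "bdd_above (sum (\<lambda>a. real (nat (zorder f a)) * (1 - norm a)) ` {F. F \<subseteq> Z \<and> finite F})"
    by (intro bdd_aboveI2[where M = "ln (M / norm (f z0)) / c"]) auto
qed

section \<open>Convergence of unordered products\<close>

lemma finite_ge_of_summable_on:
  fixes f :: "'a \<Rightarrow> real"
  assumes "f summable_on A" "t > 0"
  shows "finite {x \<in> A. f x \<ge> t}"
proof -
  have "f summable_on {x \<in> A. f x \<ge> t}"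
    by (rule summable_on_subset[OF assms(1)]) auto
  then have bound: "sum f F \<le> infsum f {x \<in> A. f x \<ge> t}"
    if "finite F" "F \<subseteq> {x \<in> A. f x \<ge> t}" for F
    using that assms(2) by (intro finite_sum_le_infsum) auto
  show ?thesis
  proof (rule ccontr)
    assume inf: "infinite {x \<in> A. f x \<ge> t}"
    obtain n :: nat where n: "infsum f {x \<in> A. f x \<ge> t} < real n * t"
      using reals_Archimedean3[OF assms(2)] by blast
    obtain F where F: "finite F" "card F = n" "F \<subseteq> {x \<in> A. f x \<ge> t}"
      using infinite_arbitrarily_large[OF inf] by blast
    have "real n * t \<le> sum f F"
      using sum_bounded_below[of F t f] F by auto
    with bound[OF F(1,3)] n show False by simp
  qed
qed

text \<open>The product is the exponential of the sum of \<open>m a * Ln (b a)\<close>, which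
  converges absolutely by \<open>|Ln (1 + u)| \<le> 2 * |u|\<close> for \<open>|u| < 1/2\<close>.
  The limit is nonzero because it is an exponential.\<close>

lemma tendsto_prod_powers_nonzero:
  fixes b :: "'a \<Rightarrow> complex" and m :: "'a \<Rightarrow> nat"
  assumes sum: "(\<lambda>a. real (m a) * norm (b a - 1)) summable_on A"
    and nz: "\<And>a. a \<in> A \<Longrightarrow> b a \<noteq> 0" and pos: "\<And>a. a \<in> A \<Longrightarrow> m a > 0"
  shows "\<exists>L. L \<noteq> 0 \<and> ((\<lambda>X. \<Prod>a\<in>X. b a ^ m a) \<longlongrightarrow> L) (finite_subsets_at_top A)"
proof -
  \<comment> \<open>\<open>F\<close> collects the indices where the logarithm estimate might fail.
    Outside \<open>F\<close>, \<open>m a \<ge> 1\<close> gives \<open>|b a - 1| < 1/2\<close>; being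
    finite, \<open>F\<close> does not affect summability.\<close>
  define F where "F = {a \<in> A. real (m a) * norm (b a - 1) \<ge> 1/2}"
  have fin: "finite F"
    unfolding F_def by (rule finite_ge_of_summable_on[OF sum]) simp
  define l where "l = (\<lambda>a. of_nat (m a) * Ln (b a))"
  have "(\<lambda>a. norm (l a)) summable_on (A - F)"
  proof (rule Infinite_Sum.abs_summable_on_comparison_test')
    show "(\<lambda>a. 2 * (real (m a) * norm (b a - 1))) summable_on (A - F)"
      by (intro summable_on_cmult_right summable_on_subset[OF sum]) auto
    fix a assume a: "a \<in> A - F"
    have "norm (b a - 1) \<le> real (m a) * norm (b a - 1)"
      using pos[of a] a by (intro mult_le_cancel_right1[THEN iffD2]) auto
    also have "\<dots> < 1/2" using a by (auto simp: F_def)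
    finally have "norm (Ln (1 + (b a - 1))) \<le> 2 * norm (b a - 1)"
      by (rule norm_Ln_le)
    then have "real (m a) * norm (Ln (b a)) \<le> real (m a) * (2 * norm (b a - 1))"
      by (intro mult_left_mono) auto
    then show "norm (l a) \<le> 2 * (real (m a) * norm (b a - 1))"
      by (simp add: l_def norm_mult)
  qed
  then have "l summable_on (A - F)" by (rule abs_summable_summable)
  then have "l summable_on ((A - F) \<union> (A \<inter> F))"
    using fin by (intro summable_on_Un_disjoint) auto
  also have "(A - F) \<union> (A \<inter> F) = A" by auto
  finally obtain S where "(l has_sum S) A" by (auto simp: summable_on_def)
  then have "((\<lambda>X. exp (sum l X)) \<longlongrightarrow> exp S) (finite_subsets_at_top A)"
    unfolding has_sum_def by (rule tendsto_exp)
  moreover have "eventually (\<lambda>X. exp (sum l X) = (\<Prod>a\<in>X. b a ^ m a)) (finite_subsets_at_top A)"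
  proof (rule eventually_finite_subsets_at_top_weakI)
    fix X assume X: "finite X" "X \<subseteq> A"
    have "exp (sum l X) = (\<Prod>a\<in>X. exp (l a))" using X(1) by (rule exp_sum)
    \<comment> \<open>The choice of branch is harmless: an integer multiple of any logarithm
      exponentiates to the power.\<close>
    also have "\<dots> = (\<Prod>a\<in>X. b a ^ m a)"
      using X nz by (intro prod.cong) (auto simp: l_def exp_of_nat_mult)
    finally show "exp (sum l X) = (\<Prod>a\<in>X. b a ^ m a)" .
  qed
  ultimately have "((\<lambda>X. \<Prod>a\<in>X. b a ^ m a) \<longlongrightarrow> exp S) (finite_subsets_at_top A)"
    by (rule Lim_transform_eventually)
  then show ?thesis by (intro exI[of _ "exp S"]) simp
qed

section \<open>Convergence and zeros of the Blaschke product\<close>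

text \<open>This turns the Blaschke condition into summability of
  \<open>m a * |blaschke_term a z - 1|\<close> at each fixed \<open>z\<close>.\<close>

lemma norm_blaschke_term_minus_1_le:
  assumes a: "norm a < 1" and z: "norm z < 1"
  shows "norm (blaschke_term a z - 1) \<le> 2 / (1 - norm z) * (1 - norm a)"
proof (cases "a = 0")
  case True
  have "norm (z - 1) \<le> 2" using norm_triangle_ineq4[of z 1] z by simp
  also have "2 \<le> 2 / (1 - norm z)" using z by (simp add: field_simps)
  finally show ?thesis using True by (simp add: blaschke_term_def)
next
  case False
  note nz = one_minus_cnj_mult_nonzero[OF a z]
  have "blaschke_term a z - 1 =
      (of_real (norm a) * (a - z) - a * (1 - cnj a * z)) / (a * (1 - cnj a * z))"
    using False nz by (simp add: blaschke_term_def field_simps)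
  also have "of_real (norm a) * (a - z) - a * (1 - cnj a * z)
      = of_real (norm a) * (a - z) - a + (a * cnj a) * z"
    by (simp add: algebra_simps)
  \<comment> \<open>Since \<open>a * cnj a = |a|^2\<close>, the normalizing factor
    \<open>|a| / a\<close> makes \<open>1 - |a|\<close> split off.\<close>
  also have "\<dots> = - (of_real (1 - norm a) * (a + of_real (norm a) * z))"
    by (simp add: complex_norm_square[symmetric] power2_eq_square algebra_simps)
  finally have eq: "norm (blaschke_term a z - 1) =
      (1 - norm a) * norm (a + of_real (norm a) * z) / (norm a * norm (1 - cnj a * z))"
    using a by (simp add: norm_divide norm_mult del: of_real_diff)
  have 1: "norm (a + of_real (norm a) * z) \<le> norm a * 2"
    using norm_triangle_ineq[of a "of_real (norm a) * z"] mult_left_le[of "norm z" "norm a"] z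
    by (simp add: norm_mult)
  have "norm (cnj a * z) \<le> norm z"
    using a by (simp add: norm_mult mult_left_le_one_le)
  then have 2: "1 - norm z \<le> norm (1 - cnj a * z)"
    using norm_triangle_ineq2[of 1 "cnj a * z"] by simp
  have "norm (blaschke_term a z - 1) \<le> (1 - norm a) * (norm a * 2) / (norm a * (1 - norm z))"
    unfolding eq using 1 2 a z False
    by (intro frac_le mult_left_mono mult_nonneg_nonneg mult_pos_pos) auto
  also have "\<dots> = 2 / (1 - norm z) * (1 - norm a)"
    using False by simp
  finally show ?thesis .
qed

lemma blaschke_term_self: "blaschke_term a a = 0"
  by (simp add: blaschke_term_def)

lemma blaschke_term_nonzero:
  assumes "norm a < 1" "norm z < 1" "z \<noteq> a"
  shows "blaschke_term a z \<noteq> 0"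
  using assms one_minus_cnj_mult_nonzero[OF assms(1,2)] by (auto simp: blaschke_term_def)

lemma Blaschke_product_tendsto:
  assumes sum: "(\<lambda>a. real (m a) * (1 - norm a)) summable_on Z"
    and Z: "Z \<subseteq> ball 0 1" and pos: "\<And>a. a \<in> Z \<Longrightarrow> m a > 0" and z: "norm z < 1"
  shows "\<exists>L. (L = 0 \<longleftrightarrow> z \<in> Z) \<and>
    ((\<lambda>X. \<Prod>a\<in>X. blaschke_term a z ^ m a) \<longlongrightarrow> L) (finite_subsets_at_top Z)"
proof (cases "z \<in> Z")
  case True
  have "eventually (\<lambda>X. (\<Prod>a\<in>X. blaschke_term a z ^ m a) = 0) (finite_subsets_at_top Z)"
    unfolding eventually_finite_subsets_at_top
  proof (intro exI[of _ "{z}"] conjI allI impI)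
    fix X assume X: "finite X \<and> {z} \<subseteq> X \<and> X \<subseteq> Z"
    \<comment> \<open>Positivity of the exponent matters here, since \<open>0 ^ 0 = 1\<close>. Every
      finite \<open>X\<close> containing \<open>z\<close> thus has product 0.\<close>
    then have "blaschke_term z z ^ m z = 0"
      using pos[OF True] by (simp add: blaschke_term_self)
    with X show "(\<Prod>a\<in>X. blaschke_term a z ^ m a) = 0"
      by (intro prod_zero) auto
  qed (use True in auto)
  then show ?thesis using True by (intro exI[of _ 0]) (simp add: tendsto_eventually)
next
  case False
  have "(\<lambda>a. norm (real (m a) * norm (blaschke_term a z - 1))) summable_on Z"
  proof (rule Infinite_Sum.abs_summable_on_comparison_test')
    show "(\<lambda>a. 2 / (1 - norm z) * (real (m a) * (1 - norm a))) summable_on Z"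
      by (intro summable_on_cmult_right sum)
    fix a assume "a \<in> Z"
    then have "real (m a) * norm (blaschke_term a z - 1)
        \<le> real (m a) * (2 / (1 - norm z) * (1 - norm a))"
      using Z z by (intro mult_left_mono norm_blaschke_term_minus_1_le) auto
    then show "norm (real (m a) * norm (blaschke_term a z - 1))
        \<le> 2 / (1 - norm z) * (real (m a) * (1 - norm a))"
      by (simp add: mult_ac abs_mult)
  qed
  then have "(\<lambda>a. real (m a) * norm (blaschke_term a z - 1)) summable_on Z"
    by simp
  moreover have "blaschke_term a z \<noteq> 0" if "a \<in> Z" for a
    using that Z z False by (intro blaschke_term_nonzero) auto
  ultimately show ?thesis
    using tendsto_prod_powers_nonzero[of m "\<lambda>a. blaschke_term a z" Z] pos False by auto
qed

section \<open>Harnack's inequality and growth of logarithms\<close>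

text \<open>For \<open>Re p > 0\<close> the Cayley transform \<open>(p - p 0) / (p + cnj (p 0))\<close> maps the disk
  to itself and fixes 0, so Schwarz's lemma applies to it.\<close>
lemma Harnack_bound:
  assumes holp: "p holomorphic_on ball 0 1" and pos: "\<And>z. norm z < 1 \<Longrightarrow> Re (p z) > 0"
    and z: "norm z < 1"
  shows "(1 - norm z) * Re (p z) \<le> 2 * Re (p 0)"
proof -
  define q where "q = (\<lambda>z. (p z - p 0) / (p z + cnj (p 0)))"
  have p0: "Re (p 0) > 0" using pos[of 0] by simp
  have den: "p w + cnj (p 0) \<noteq> 0" if "norm w < 1" for w
    using pos[OF that] p0 by (auto simp: complex_eq_iff)
  have "norm (q z) \<le> norm z"
  proof (rule Schwarz_Lemma[OF _ _ _ z])
    show "q holomorphic_on ball 0 1"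
      unfolding q_def using den by (intro holomorphic_intros holp) auto
    show "q 0 = 0" by (simp add: q_def)
    show "norm (q w) < 1" if w: "norm w < 1" for w
    proof -
      \<comment> \<open>The two squares differ by \<open>4 * Re (p w) * Re (p 0)\<close>.\<close>
      have "(norm (p w - p 0))\<^sup>2 < (norm (p w + cnj (p 0)))\<^sup>2"
        using mult_pos_pos[OF pos[OF w] p0]
        unfolding cmod_power2 by (simp add: power2_eq_square algebra_simps)
      then have "norm (p w - p 0) < norm (p w + cnj (p 0))"
        by (rule power_less_imp_less_base) simp
      then show ?thesis using den[OF w] by (simp add: q_def norm_divide)
    qed
  qed
  moreover have "1 - norm (q z) \<le> norm (1 - q z)"
    using norm_triangle_ineq2[of 1 "q z"] by simp
  ultimately have "1 - norm z \<le> norm (1 - q z)" by linarith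
  \<comment> \<open>This identity turns the lower bound on \<open>|1 - q z|\<close> into an upper
    bound on \<open>|p z + cnj (p 0)|\<close>, which dominates \<open>Re (p z)\<close>.\<close>
  moreover have "1 - q z = of_real (2 * Re (p 0)) / (p z + cnj (p 0))"
  proof -
    have "1 - q z = (p 0 + cnj (p 0)) / (p z + cnj (p 0))"
      using den[OF z] by (simp add: q_def field_simps)
    then show ?thesis by (simp only: complex_add_cnj)
  qed
  ultimately have "1 - norm z \<le> 2 * Re (p 0) / norm (p z + cnj (p 0))"
    using p0 by (simp add: norm_divide del: of_real_mult)
  then have "(1 - norm z) * norm (p z + cnj (p 0)) \<le> 2 * Re (p 0)"
    using den[OF z] by (simp add: pos_le_divide_eq)
  moreover have "(1 - norm z) * Re (p z) \<le> (1 - norm z) * norm (p z + cnj (p 0))"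
    using z p0 complex_Re_le_cmod[of "p z + cnj (p 0)"] by (intro mult_left_mono) auto
  ultimately show ?thesis by linarith
qed

text \<open>The bound is strict so that \<open>ln M - ln |f z|\<close> is strictly positive, as
  \<open>Harnack_bound\<close> demands.\<close>

lemma H_infinity_bound:
  assumes "f \<in> H_infinity"
  obtains M where "M > 0" "\<And>z. norm z < 1 \<Longrightarrow> norm (f z) < M"
proof -
  from assms obtain B where B: "\<And>z. norm z < 1 \<Longrightarrow> norm (f z) \<le> B"
    unfolding H_infinity_def bounded_iff by fastforce
  show thesis
    by (rule that[of "\<bar>B\<bar> + 1"]) (auto dest!: B)
qed

text \<open>On the simply connected disk a zero-free \<open>f\<close> is \<open>exp h\<close>. Then
  \<open>p = ln M - h\<close> has real part \<open>ln (M / |f|) > 0\<close>, so Harnack bounds it,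
  and \<open>|ln |f||\<close> is at most \<open>|ln M| + Re p\<close>.\<close>

lemma log_growth_nonvanishing:
  assumes f: "f \<in> H_infinity" and nz: "\<And>z. norm z < 1 \<Longrightarrow> f z \<noteq> 0"
  shows "\<exists>C. \<forall>z. norm z < 1 \<longrightarrow> (1 - norm z) * \<bar>ln (norm (f z))\<bar> \<le> C"
proof -
  obtain M where M: "M > 0" "\<And>z. norm z < 1 \<Longrightarrow> norm (f z) < M"
    using H_infinity_bound[OF f] by blast
  have "f holomorphic_on ball 0 1" using f by (simp add: H_infinity_def)
  moreover have "simply_connected (ball (0::complex) 1)"
    by (simp add: convex_imp_simply_connected)
  ultimately obtain h where h: "h holomorphic_on ball 0 1"
    "\<And>z. norm z < 1 \<Longrightarrow> f z = exp (h z)"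
    using nz simply_connected_eq_holomorphic_log[of "ball 0 1"] by (auto simp: dist_norm)
  define p where "p = (\<lambda>z. of_real (ln M) - h z)"
  have ln: "ln (norm (f z)) = ln M - Re (p z)" if "norm z < 1" for z
    using h(2)[OF that] by (simp add: p_def)
  have pos: "Re (p z) > 0" if z: "norm z < 1" for z
    using M(2)[OF z] ln[OF z] nz[OF z] ln_less_cancel_iff[of "norm (f z)" M] M(1) by simp
  have holp: "p holomorphic_on ball 0 1"
    unfolding p_def by (intro holomorphic_intros h)
  have "(1 - norm z) * \<bar>ln (norm (f z))\<bar> \<le> \<bar>ln M\<bar> + 2 * Re (p 0)" if z: "norm z < 1" for z
  proof -
    have "(1 - norm z) * \<bar>ln (norm (f z))\<bar> \<le> (1 - norm z) * (\<bar>ln M\<bar> + Re (p z))"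
      using z pos[OF z] ln[OF z] by (intro mult_left_mono) auto
    also have "\<dots> = (1 - norm z) * \<bar>ln M\<bar> + (1 - norm z) * Re (p z)"
      by (simp add: distrib_left)
    also have "\<dots> \<le> \<bar>ln M\<bar> + 2 * Re (p 0)"
      using Harnack_bound[OF holp pos z] z by (intro add_mono) (auto simp: mult_left_le_one_le)
    finally show ?thesis .
  qed
  then show ?thesis by blast
qed

section \<open>Growth and Blaschke factors in the Smirnov class\<close>

text \<open>The outer denominator is a unimodular constant times an exponential, hence
  zero-free.\<close>

lemma smirnov_classE:
  assumes "\<phi> \<in> smirnov_class"
  obtains f g where "f \<in> H_infinity" "g \<in> H_infinity" "\<And>z. norm z < 1 \<Longrightarrow> g z \<noteq> 0"
    "\<And>z. norm z < 1 \<Longrightarrow> \<phi> z = f z / g z"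
proof -
  from assms obtain f g where fg: "f \<in> H_infinity" "g \<in> H_infinity" "outer_function g"
    "\<And>z. norm z < 1 \<Longrightarrow> \<phi> z = f z / g z"
    by (auto simp: smirnov_class_def)
  have "g z \<noteq> 0" if "norm z < 1" for z
    using fg(3) that by (fastforce simp: outer_function_def)
  with fg that show thesis by blast
qed

lemma smirnov_log_growth:
  assumes "\<phi> \<in> smirnov_class" and nz: "\<And>z. norm z < 1 \<Longrightarrow> \<phi> z \<noteq> 0"
  shows "\<exists>C. \<forall>z. norm z < 1 \<longrightarrow> (1 - norm z) * \<bar>ln (norm (\<phi> z))\<bar> \<le> C"
proof -
  obtain f g where fg: "f \<in> H_infinity" "g \<in> H_infinity" "\<And>z. norm z < 1 \<Longrightarrow> g z \<noteq> 0"
    "\<And>z. norm z < 1 \<Longrightarrow> \<phi> z = f z / g z"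
    using smirnov_classE[OF assms(1)] by blast
  have fnz: "f z \<noteq> 0" if "norm z < 1" for z using nz[OF that] fg(4)[OF that] by auto
  obtain A where A: "\<And>z. norm z < 1 \<Longrightarrow> (1 - norm z) * \<bar>ln (norm (f z))\<bar> \<le> A"
    using log_growth_nonvanishing[OF fg(1) fnz] by blast
  obtain B where B: "\<And>z. norm z < 1 \<Longrightarrow> (1 - norm z) * \<bar>ln (norm (g z))\<bar> \<le> B"
    using log_growth_nonvanishing[OF fg(2,3)] by blast
  have "(1 - norm z) * \<bar>ln (norm (\<phi> z))\<bar> \<le> A + B" if z: "norm z < 1" for z
  proof -
    have "ln (norm (\<phi> z)) = ln (norm (f z)) - ln (norm (g z))"
      using fnz[OF z] fg(3,4)[OF z] by (simp add: norm_divide ln_div)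
    then have "(1 - norm z) * \<bar>ln (norm (\<phi> z))\<bar>
        \<le> (1 - norm z) * (\<bar>ln (norm (f z))\<bar> + \<bar>ln (norm (g z))\<bar>)"
      using z by (intro mult_left_mono) auto
    then show ?thesis using A[OF z] B[OF z] by (simp add: distrib_left)
  qed
  then show ?thesis by blast
qed

text \<open>As \<open>g\<close> is zero-free, \<open>\<phi>\<close> and \<open>f\<close> have the
  same zeros with the same orders, so the Blaschke condition for the bounded function
  \<open>f\<close> passes to \<open>\<phi>\<close>. The point \<open>z0\<close> excludes the zero
  function.\<close>

lemma smirnov_Blaschke_factor_exists:
  assumes "\<phi> \<in> smirnov_class" and z0: "norm z0 < 1" "\<phi> z0 \<noteq> 0"
  shows "\<exists>B. is_blaschke_factor \<phi> B \<and> (\<forall>z. norm z < 1 \<longrightarrow> (B z = 0 \<longleftrightarrow> \<phi> z = 0))"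
proof -
  obtain f g where fg: "f \<in> H_infinity" "g \<in> H_infinity" "\<And>z. norm z < 1 \<Longrightarrow> g z \<noteq> 0"
    "\<And>z. norm z < 1 \<Longrightarrow> \<phi> z = f z / g z"
    using smirnov_classE[OF assms(1)] by blast
  have holf: "f holomorphic_on ball 0 1" and holg: "g holomorphic_on ball 0 1"
    using fg(1,2) by (simp_all add: H_infinity_def)
  have hol: "(\<lambda>z. f z / g z) holomorphic_on ball 0 1"
    using fg(3) by (intro holomorphic_intros holf holg) auto
  then have hol\<phi>: "\<phi> holomorphic_on ball 0 1"
    by (rule holomorphic_transform) (use fg(4) in auto)
  have eq: "f z = \<phi> z * g z" if "norm z < 1" for z
    using fg(3,4)[OF that] by simp
  have f0: "f z0 \<noteq> 0" using eq fg(3) z0 by simp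
  have ord: "zorder f a = zorder \<phi> a" if a: "norm a < 1" for a
  proof -
    have "zorder g a = 0"
      using holg a fg(3)[OF a] by (intro zorder_eq_0I analytic_at_disk)
    then show ?thesis
      using zorder_mult_disk[OF hol\<phi> holg eq z0(1) f0 a] by simp
  qed
  let ?Z = "disk_zeros \<phi>"
  define m where "m = (\<lambda>a. nat (zorder \<phi> a))"
  have Z: "?Z \<subseteq> ball 0 1" by (auto simp: disk_zeros_def)
  have pos: "m a > 0" if "a \<in> ?Z" for a
  proof -
    have a: "norm a < 1" "\<phi> a = 0" using that by (auto simp: disk_zeros_def)
    have "frequently (\<lambda>z. \<phi> z \<noteq> 0) (at a)"
      using eventually_nonzero_disk[OF hol\<phi> z0 a(1)] by (intro eventually_frequently) auto
    then show ?thesis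
      using zorder_pos_iff[OF hol\<phi>, of a] a by (simp add: m_def)
  qed
  obtain M where M: "\<And>z. norm z < 1 \<Longrightarrow> norm (f z) < M"
    using H_infinity_bound[OF fg(1)] by blast
  have "(\<lambda>a. real (nat (zorder f a)) * (1 - norm a)) summable_on ?Z"
    using Z by (intro Blaschke_condition[OF holf less_imp_le[OF M] z0(1) f0])
      (auto simp: disk_zeros_def eq)
  also have "?this \<longleftrightarrow> (\<lambda>a. real (m a) * (1 - norm a)) summable_on ?Z"
    using Z by (intro summable_on_cong) (auto simp: m_def ord subset_iff)
  finally have sum: "(\<lambda>a. real (m a) * (1 - norm a)) summable_on ?Z" .
  \<comment> \<open>The restriction to the disk sits inside the existential so that choice yields a
    total \<open>B\<close>, arbitrary off the disk.\<close>
  have "\<forall>z. \<exists>L. norm z < 1 \<longrightarrow> (L = 0 \<longleftrightarrow> z \<in> ?Z) \<and>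
      ((\<lambda>X. \<Prod>a\<in>X. blaschke_term a z ^ m a) \<longlongrightarrow> L) (finite_subsets_at_top ?Z)"
    using Blaschke_product_tendsto[of m, OF sum Z pos] by blast
  then obtain B where B: "\<And>z. norm z < 1 \<Longrightarrow> (B z = 0 \<longleftrightarrow> z \<in> ?Z) \<and>
      ((\<lambda>X. \<Prod>a\<in>X. blaschke_term a z ^ m a) \<longlongrightarrow> B z) (finite_subsets_at_top ?Z)"
    by metis
  then show ?thesis
    by (intro exI[of _ B]) (auto simp: is_blaschke_factor_def m_def disk_zeros_def)
qed

theorem theorem5p1:
  fixes \<Lambda> w :: "nat \<Rightarrow> complex" and \<phi> :: "complex \<Rightarrow> complex"
  assumes "interpolating_sequence \<Lambda>"
    and "\<And>n. w n \<noteq> 0"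
    and "bounded (range w)"
    and "limsup (\<lambda>n. ereal ((1 - cmod (\<Lambda> n)) * \<bar>ln (cmod (w n))\<bar>)) = \<infinity>"
    and "\<phi> \<in> smirnov_class"
    and "\<And>n. \<phi> (\<Lambda> n) = w n"
  shows "(\<exists>B. is_blaschke_factor \<phi> B \<and> \<not> B constant_on unit_disk)
       \<and> (\<exists>z\<in>unit_disk. \<phi> z = 0)"
proof -
  have disk: "norm (\<Lambda> n) < 1" for n
  proof -
    have "\<Lambda> n \<in> unit_disk"
      using assms(1) unfolding interpolating_sequence_def by blast
    then show ?thesis by simp
  qed
  have "\<exists>z. norm z < 1 \<and> \<phi> z = 0"
  proof (rule ccontr)
    assume "\<not> ?thesis"
    then obtain C where "\<And>z. norm z < 1 \<Longrightarrow> (1 - norm z) * \<bar>ln (norm (\<phi> z))\<bar> \<le> C"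
      using smirnov_log_growth[OF assms(5)] by blast
    \<comment> \<open>Evaluating the growth bound at the points \<open>\<Lambda> n\<close> keeps the
      limsup at most \<open>C\<close>, contradicting its being infinite.\<close>
    then have "ereal ((1 - cmod (\<Lambda> n)) * \<bar>ln (cmod (w n))\<bar>) \<le> ereal C" for n
      using disk[of n] assms(6)[of n] by (metis ereal_less_eq(3))
    then have "limsup (\<lambda>n. ereal ((1 - cmod (\<Lambda> n)) * \<bar>ln (cmod (w n))\<bar>)) \<le> ereal C"
      by (intro Limsup_bounded always_eventually) blast
    with assms(4) show False by simp
  qed
  then obtain z where z: "norm z < 1" "\<phi> z = 0" by blast
  \<comment> \<open>\<open>\<Lambda> 0\<close> serves twice: as the point showing that
    \<open>\<phi>\<close> is not identically zero, and as a point where \<open>B\<close> differs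
    from its value 0 at \<open>z\<close>.\<close>
  have nz: "\<phi> (\<Lambda> 0) \<noteq> 0" using assms(2,6) by simp
  obtain B where B: "is_blaschke_factor \<phi> B" "\<And>z. norm z < 1 \<Longrightarrow> B z = 0 \<longleftrightarrow> \<phi> z = 0"
    using smirnov_Blaschke_factor_exists[OF assms(5) disk nz] by blast
  have "\<not> B constant_on unit_disk"
  proof
    assume "B constant_on unit_disk"
    then have "B z = B (\<Lambda> 0)"
      using z(1) disk[of 0] by (auto simp: constant_on_def)
    with B(2)[OF z(1)] B(2)[OF disk[of 0]] z(2) nz show False by simp
  qed
  with B(1) z show ?thesis by auto
qed

end
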